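(* Let $p$ be a prime, let $c\in(0,1)$, and let $Y$ be a real-valued random variable with $\mathbb{E}[|Y|^\alpha]<\infty$ for some $\alpha>0$. Let $\{Y_n^k\}_{k\in\mathbb{N},\,0\le n\le p^k-1}$ be i.i.d. random variables with the law of $Y$, extended periodically to all $n\ge0$ by $Y^k_\ell=Y^k_n$ whenever $\ell\equiv n\pmod{p^k}$, and define $$X_n:=\sum_{k=1}^\infty c^k\,(Y_n^k-Y_0^k),\qquad n\ge 0.$$ Then the process $\{X_n\}_{n\ge0}$ has bounded sample paths if and only if $\mathbb{E}\big[|Y|^{-\frac{\log p}{\log c}}\big]<\infty$.
   Context: $\mathbb{N}=\{1,2,\dots\}$. "Bounded sample paths" means $\sup_{n\ge0}|X_n|<\infty$ almost surely. *)

theory Defs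
  imports "HOL-Probability.Probability" "HOL-Computational_Algebra.Primes"
begin

definition periodic_ext :: "nat \<Rightarrow> (nat \<Rightarrow> nat \<Rightarrow> 'a \<Rightarrow> real) \<Rightarrow> nat \<Rightarrow> nat \<Rightarrow> 'a \<Rightarrow> real" where
  "periodic_ext p Y k l = Y k (l mod p ^ k)"

text \<open>
  The series starts at level 1, hence the shift by \<open>Suc\<close>.
  On sample points where it diverges, \<open>suminf\<close> returns an unspecified real; if the \<open>Y k n\<close>
  are identically distributed with a finite absolute moment of some positive order, this is a
  null event for every \<open>n\<close>.
\<close>
definition series_process ::
    "nat \<Rightarrow> real \<Rightarrow> (nat \<Rightarrow> nat \<Rightarrow> 'a \<Rightarrow> real) \<Rightarrow> nat \<Rightarrow> 'a \<Rightarrow> real" where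
  "series_process p c Y n \<omega> =
     (\<Sum>k. c ^ Suc k * (periodic_ext p Y (Suc k) n \<omega> - periodic_ext p Y (Suc k) 0 \<omega>))"

definition bounded_sample_paths :: "'a measure \<Rightarrow> (nat \<Rightarrow> 'a \<Rightarrow> real) \<Rightarrow> bool" where
  "bounded_sample_paths M X \<longleftrightarrow> (AE \<omega> in M. (SUP n. ereal \<bar>X n \<omega>\<bar>) < \<infinity>)"

end

theory Submission
  imports Defs
begin

text \<open>
  Write \<open>q = - ln p / ln c\<close>, so that \<open>c powr q = 1 / p\<close>. The indices \<open>n\<close> are branches of the
  \<open>p\<close>-adic tree whose level \<open>k\<close> has \<open>p ^ k\<close> nodes, and \<open>E |Y| powr q < \<infinity>\<close> says that the expected
  number of nodes with \<open>c ^ k * |Y| > y\<close> is finite. Only pairwise independence is used.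

  If the moment is finite, put \<open>r = c powr (1/4)\<close>. The expected number of pairs of nodes on a common
  branch, at levels \<open>k < l\<close>, whose weighted values both exceed \<open>r ^ k\<close> decays geometrically in \<open>k\<close>.
  Hence almost surely, from some level on, a value exceeding \<open>r ^ k\<close> at level \<open>k\<close> forces all later
  values on the branch to be at most \<open>r ^ k\<close>, and this bounds the sums along all branches uniformly.

  If the moment is infinite, take finitely many nodes for which the probabilities that the weighted
  value exceeds a large \<open>a\<close> add up to about \<open>1/2\<close>. By the second Bonferroni inequality, with
  probability bounded below one of these nodes is hit while the remaining terms on its branch and on
  the branch of \<open>0\<close> are dominated by a fixed geometric series.
\<close>

section \<open>Bounds for sums and for probabilities of unions\<close>

text \<open>Call a level from \<open>K\<close> on big if \<open>w k > r ^ k\<close>. By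
  \<open>lac\<close>, a big level \<open>b\<close> caps all later values by \<open>r ^ b\<close>. So
  the first big level costs at most \<open>B\<close>, each further one is charged to the big level
  before it, and the other levels are charged to themselves. The two kinds of charges form two
  geometric sums.\<close>

lemma lacunary_sum_bound:
  fixes w :: "nat \<Rightarrow> real"
  assumes w: "\<And>k. 0 \<le> w k" "\<And>k. w k \<le> B"
    and r: "0 < r" "r < 1"
    and lac: "\<And>k l. K \<le> k \<Longrightarrow> k < l \<Longrightarrow> w k \<le> r ^ k \<or> w l \<le> r ^ k"
  shows "(\<Sum>k<m. w k) \<le> real K * B + B + 2 / (1 - r)"
proof -
  define S where "S m = (\<Sum>k<m. r ^ k)" for m
  have S0: "0 \<le> S m" for m using r by (auto simp: S_def intro: sum_nonneg)
  have S1: "S m \<le> 1 / (1 - r)" for m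
    using sum_le_suminf[of "\<lambda>k. r ^ k" "{..<m}"] r
    by (simp add: S_def summable_geometric suminf_geometric)
  have Smono: "S m \<le> S n" if "m \<le> n" for m n
    unfolding S_def using r that by (intro sum_mono2) auto
  have B0: "0 \<le> B" using w[of 0] by linarith
  \<comment> \<open>\<open>b\<close> is the last big level below \<open>K + i\<close>; the summand \<open>S b\<close> pays for all big levels but the first.\<close>
  have inv: "(\<Sum>k<i. w (K + k)) \<le> S (K + i) \<or>
      (\<exists>b\<ge>K. b < K + i \<and> r ^ b < w b \<and> (\<Sum>k<i. w (K + k)) \<le> B + S (K + i) + S b)" for i
  proof (induction i)
    case 0
    then show ?case using S0 by simp
  next
    case (Suc i)
    have SS: "S (K + Suc i) = S (K + i) + r ^ (K + i)" by (simp add: S_def)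
    from Suc.IH show ?case
    proof
      assume a: "(\<Sum>k<i. w (K + k)) \<le> S (K + i)"
      show ?thesis
      proof (cases "w (K + i) \<le> r ^ (K + i)")
        case True
        then show ?thesis using a SS by simp
      next
        case False
        have "(\<Sum>k<Suc i. w (K + k)) \<le> B + S (K + Suc i) + S (K + i)"
          using a w(2)[of "K + i"] S0[of "K + Suc i"] by simp
        then show ?thesis using False by (intro disjI2 exI[of _ "K + i"]) auto
      qed
    next
      assume "\<exists>b\<ge>K. b < K + i \<and> r ^ b < w b \<and> (\<Sum>k<i. w (K + k)) \<le> B + S (K + i) + S b"
      then obtain b where b: "K \<le> b" "b < K + i" "r ^ b < w b"
          "(\<Sum>k<i. w (K + k)) \<le> B + S (K + i) + S b" by blast
      show ?thesis
      proof (cases "w (K + i) \<le> r ^ (K + i)")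
        case True
        then show ?thesis using b SS by (intro disjI2 exI[of _ b]) auto
      next
        case False
        \<comment> \<open>Bigness of \<open>b\<close> rules out the first alternative of
          \<open>lac\<close>. The new value fits into the increment from \<open>S b\<close> to
          \<open>S (Suc b)\<close>, and \<open>K + i\<close> becomes the last big level.\<close>
        have "w (K + i) \<le> r ^ b" using lac[OF b(1,2)] b(3) by auto
        moreover have "S b + r ^ b = S (Suc b)" by (simp add: S_def)
        moreover have "S (Suc b) \<le> S (K + i)" using b by (intro Smono) auto
        moreover have "0 \<le> r ^ (K + i)" using r by simp
        ultimately have "(\<Sum>k<Suc i. w (K + k)) \<le> B + S (K + Suc i) + S (K + i)"
          using b(4) SS by simp
        then show ?thesis using False by (intro disjI2 exI[of _ "K + i"]) auto
      qed
    qed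
  qed
  have tail: "(\<Sum>k<i. w (K + k)) \<le> B + 2 / (1 - r)" for i
  proof -
    have "(\<Sum>k<i. w (K + k)) \<le> B + (1 / (1 - r) + 1 / (1 - r))"
      using inv[of i] S1[of "K + i"] S1 S0 B0
      by (smt (verit, best))
    then show ?thesis by simp
  qed
  have "(\<Sum>k<m. w k) \<le> (\<Sum>k<K + m. w k)" using w by (intro sum_mono2) auto
  also have "\<dots> = (\<Sum>k<K. w k) + (\<Sum>k<m. w (K + k))"
    by (induction m) (auto simp: add.assoc)
  also have "(\<Sum>k<K. w k) \<le> real K * B" using sum_bounded_above[of "{..<K}" w B] w by simp
  finally show ?thesis using tail[of m] by linarith
qed

text \<open>Adding the indices one at a time starts below \<open>t\<close>, and a step that carries
  the sum from below \<open>t\<close> to at least \<open>t\<close> overshoots by at most one value,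
  hence by at most \<open>e\<close>.\<close>

lemma subset_sum_between:
  fixes h :: "'i \<Rightarrow> real"
  assumes "finite I" "\<And>i. i \<in> I \<Longrightarrow> h i \<le> e" "t \<le> sum h I" "0 < t"
  shows "\<exists>J\<subseteq>I. t \<le> sum h J \<and> sum h J \<le> t + e"
  using assms
proof (induction I rule: finite_induct)
  case empty
  then show ?case by simp
next
  case (insert x F)
  show ?case
  proof (cases "t \<le> sum h F")
    case True
    then obtain J where "J \<subseteq> F" "t \<le> sum h J" "sum h J \<le> t + e"
      using insert by auto
    then show ?thesis by blast
  next
    case False
    have "h x \<le> e" using insert.prems by simp
    moreover have "sum h (insert x F) = h x + sum h F" using insert by simp
    ultimately have "t \<le> sum h (insert x F) \<and> sum h (insert x F) \<le> t + e"
      using False insert.prems(2) by linarith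
    then show ?thesis by blast
  qed
qed

context prob_space
begin

text \<open>Inclusion-exclusion for one more event loses at most \<open>h x * sum h F\<close>, and
  these losses add up to at most half the square of the total. The factor \<open>\<theta>\<close>
  allows each \<open>G i\<close> to be a part of a larger event of probability \<open>h i\<close>
  that controls the intersections.\<close>

lemma bonferroni_pairwise:
  assumes "finite I" "\<And>i. i \<in> I \<Longrightarrow> G i \<in> events"
    and "\<And>i. i \<in> I \<Longrightarrow> \<theta> * h i \<le> prob (G i)"
    and "\<And>i j. i \<in> I \<Longrightarrow> j \<in> I \<Longrightarrow> i \<noteq> j \<Longrightarrow> prob (G i \<inter> G j) \<le> h i * h j"
  shows "\<theta> * sum h I - (sum h I)\<^sup>2 / 2 \<le> prob (\<Union>i\<in>I. G i)"
  using assms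
proof (induction I rule: finite_induct)
  case empty
  then show ?case by simp
next
  case (insert x F)
  let ?U = "\<Union>i\<in>F. G i"
  have U: "?U \<in> events" using insert by auto
  have Gx: "G x \<in> events" using insert by auto
  have IH: "\<theta> * sum h F - (sum h F)\<^sup>2 / 2 \<le> prob ?U"
    using insert by auto
  have "prob (G x \<inter> ?U) = prob (\<Union>i\<in>F. G x \<inter> G i)" by (rule arg_cong[where f=prob]) auto
  also have "\<dots> \<le> (\<Sum>i\<in>F. prob (G x \<inter> G i))"
    using insert.hyps insert.prems(1) by (intro finite_measure_subadditive_finite) auto
  also have "\<dots> \<le> (\<Sum>i\<in>F. h x * h i)" using insert.prems(3) insert.hyps by (intro sum_mono) auto
  finally have i: "prob (G x \<inter> ?U) \<le> h x * sum h F" by (simp add: sum_distrib_left)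
  have "prob (G x \<union> ?U) = prob (G x) + prob ?U - prob (G x \<inter> ?U)"
    using finite_measure_Union'[OF Gx U] finite_measure_Diff'[OF U Gx] by (simp add: Int_commute)
  moreover have "\<theta> * h x \<le> prob (G x)" using insert.prems by auto
  moreover have "0 \<le> h x * h x" by simp
  moreover have "\<theta> * sum h (insert x F) - (sum h (insert x F))\<^sup>2 / 2
      = \<theta> * h x + (\<theta> * sum h F - (sum h F)\<^sup>2 / 2) - h x * sum h F - h x * h x / 2"
    using insert.hyps by (simp add: power2_eq_square algebra_simps add_divide_distrib)
  moreover have "(\<Union>i\<in>insert x F. G i) = G x \<union> ?U" by simp
  ultimately show ?case using IH i by (simp only:)
qed

end

section \<open>The weighted values on the tree\<close>

text \<open>The index \<open>k\<close> stands for tree level \<open>Suc k\<close>, a node being a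
  residue modulo \<open>p ^ Suc k\<close>; by \<open>W_mod\<close> an arbitrary \<open>n\<close>
  then names a whole branch. The law of the values enters only through \<open>tail\<close>, so the
  space carrying \<open>Y\<close> does not appear.\<close>

locale level_array = prob_space M for M :: "'a measure" +
  fixes p :: nat and c :: real and W :: "nat \<Rightarrow> nat \<Rightarrow> 'a \<Rightarrow> real" and tail :: "real \<Rightarrow> real"
  assumes p2: "2 \<le> p" and c: "0 < c" "c < 1"
    and W_meas [measurable]: "\<And>k n. W k n \<in> borel_measurable M"
    and W_mod: "\<And>k n. W k (n mod p ^ Suc k) = W k n"
    and prob_W: "\<And>k n s. prob {\<omega> \<in> space M. s < \<bar>W k n \<omega>\<bar>} = tail s"
    and prob_W2: "\<And>k n l m s t. (k, n mod p ^ Suc k) \<noteq> (l, m mod p ^ Suc l) \<Longrightarrow>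
      prob {\<omega> \<in> space M. s < \<bar>W k n \<omega>\<bar> \<and> t < \<bar>W l m \<omega>\<bar>} = tail s * tail t"
begin

lemma tail_nonneg: "0 \<le> tail s"
  using prob_W[of s 0 0] measure_nonneg by metis

lemma less_weight_iff: "y < c ^ k * x \<longleftrightarrow> y / c ^ k < x"
  using c by (simp add: divide_less_eq mult.commute)

section \<open>Finite moment: a bound uniform over all branches\<close>

text \<open>The hypothesis says that the expected number of nodes with weighted value above 1 is
  finite. By Borel-Cantelli only finitely many levels contain such a node, and by periodicity each
  level has finitely many values; the sum over those levels plus 1 serves as
  \<open>B\<close>.\<close>

lemma AE_terms_bounded:
  assumes "summable (\<lambda>k. real p ^ Suc k * tail (1 / c ^ Suc k))"
  shows "AE \<omega> in M. \<exists>B. \<forall>k n. c ^ Suc k * \<bar>W k n \<omega>\<bar> \<le> B"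
proof -
  define A where "A k = (\<Union>n<p ^ Suc k. {\<omega> \<in> space M. 1 / c ^ Suc k < \<bar>W k n \<omega>\<bar>})" for k
  have A [measurable]: "A k \<in> events" for k unfolding A_def by measurable
  have "prob (A k) \<le> real p ^ Suc k * tail (1 / c ^ Suc k)" for k
  proof -
    have "prob (A k) \<le> (\<Sum>n<p ^ Suc k. prob {\<omega> \<in> space M. 1 / c ^ Suc k < \<bar>W k n \<omega>\<bar>})"
      unfolding A_def by (intro finite_measure_subadditive_finite) auto
    then show ?thesis by (simp add: prob_W)
  qed
  then have "summable (\<lambda>k. prob (A k))"
    by (intro summable_comparison_test'[OF assms]) auto
  then have "AE \<omega> in M. eventually (\<lambda>k. \<omega> \<in> space M - A k) sequentially"
    by (intro borel_cantelli_AE1) (auto simp: emeasure_eq_measure)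
  then show ?thesis
  proof (eventually_elim)
    case (elim \<omega>)
    then obtain K where K: "\<And>k. k \<ge> K \<Longrightarrow> \<omega> \<in> space M - A k"
      unfolding eventually_sequentially by blast
    define B where "B = 1 + (\<Sum>k<K. \<Sum>n<p ^ Suc k. c ^ Suc k * \<bar>W k n \<omega>\<bar>)"
    have B1: "1 \<le> B" unfolding B_def using c by (simp add: sum_nonneg)
    have "c ^ Suc k * \<bar>W k n \<omega>\<bar> \<le> B" for k n
    proof -
      define n' where "n' = n mod p ^ Suc k"
      have n': "n' < p ^ Suc k" unfolding n'_def using p2 by (intro mod_less_divisor) auto
      have "c ^ Suc k * \<bar>W k n' \<omega>\<bar> \<le> B"
      proof (cases "k < K")
        case True
        have "c ^ Suc k * \<bar>W k n' \<omega>\<bar> \<le> (\<Sum>n<p ^ Suc k. c ^ Suc k * \<bar>W k n \<omega>\<bar>)"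
          using n' c by (intro member_le_sum) auto
        also have "\<dots> \<le> (\<Sum>k<K. \<Sum>n<p ^ Suc k. c ^ Suc k * \<bar>W k n \<omega>\<bar>)"
          using True c
          by (intro member_le_sum[of k "{..<K}" "\<lambda>k. \<Sum>n<p ^ Suc k. c ^ Suc k * \<bar>W k n \<omega>\<bar>"])
            (auto intro!: sum_nonneg)
        finally show ?thesis unfolding B_def by simp
      next
        case False
        then have "\<not> 1 / c ^ Suc k < \<bar>W k n' \<omega>\<bar>" using K[of k] n' unfolding A_def by auto
        then have "c ^ Suc k * \<bar>W k n' \<omega>\<bar> \<le> 1"
          using less_weight_iff[of 1 "Suc k" "\<bar>W k n' \<omega>\<bar>"] by linarith
        then show ?thesis using B1 by linarith
      qed
      then show ?thesis unfolding n'_def W_mod .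
    qed
    then show ?case by blast
  qed
qed

text \<open>Borel-Cantelli for the events \<open>D k\<close> supplies the level \<open>K\<close> of
  \<open>lacunary_sum_bound\<close>, and \<open>AE_terms_bounded\<close> supplies \<open>B\<close>.
  Neither depends on the branch.\<close>

lemma AE_branch_sums_bounded:
  assumes pq: "c powr q = 1 / real p" and C: "0 \<le> C"
    and tail_le: "\<And>s. 0 < s \<Longrightarrow> tail s \<le> C * s powr - q"
    and levels_le: "\<And>y. 0 < y \<Longrightarrow>
      (\<Sum>k. ennreal (real p ^ Suc k * tail (y / c ^ Suc k))) \<le> ennreal (C * y powr - q)"
  shows "AE \<omega> in M. \<exists>B. \<forall>n m. (\<Sum>k<m. c ^ Suc k * \<bar>W k n \<omega>\<bar>) \<le> B"
proof -
  \<comment> \<open>For \<open>r = c powr s\<close> the bound on \<open>prob (D k)\<close> is of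
    order \<open>c powr (q * (1 - 2 * s) * k)\<close>, so any \<open>s\<close> strictly between 0
    and 1/2 gives decay. The choice \<open>s = 1/4\<close> yields the ratio
    \<open>p powr (-1/2)\<close>.\<close>
  define r where "r = c powr (1/4)"
  have r: "0 < r" "r < 1" using c powr_less_mono2[of "1/4" c 1] by (auto simp: r_def)
  define E where "E k l n = (if k < l then
    {\<omega> \<in> space M. r ^ k / c ^ Suc k < \<bar>W k n \<omega>\<bar> \<and> r ^ k / c ^ Suc l < \<bar>W l n \<omega>\<bar>} else {})" for k l n
  have E [measurable]: "E k l n \<in> events" for k l n
    unfolding E_def by (cases "k < l") (simp_all, measurable)
  \<comment> \<open>A pair of nodes on a common branch is indexed by its deeper node alone, which
    determines the ancestor at level \<open>k\<close>. Hence only \<open>p ^ Suc l\<close> events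
    are needed for each \<open>l\<close>.\<close>
  define D where "D k = (\<Union>l. \<Union>n<p ^ Suc l. E k l n)" for k
  have D [measurable]: "D k \<in> events" for k unfolding D_def by measurable
  have E_le: "prob (E k l n) \<le> tail (r ^ k / c ^ Suc k) * tail (r ^ k / c ^ Suc l)" for k l n
    using prob_W2[of k n l n "r ^ k / c ^ Suc k" "r ^ k / c ^ Suc l"]
    by (simp add: E_def tail_nonneg)
  have D_le: "prob (D k) \<le> C\<^sup>2 * (p powr (-1/2)) ^ k" for k
  proof -
    let ?a = "tail (r ^ k / c ^ Suc k)"
    have "emeasure M (D k) \<le> (\<Sum>l. emeasure M (\<Union>n<p ^ Suc l. E k l n))"
      unfolding D_def by (intro emeasure_subadditive_countably) auto
    \<comment> \<open>For \<open>l \<le> k\<close> the events are empty and the bound is trivial.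
      Summing over all \<open>l\<close> makes \<open>levels_le\<close> applicable with
      \<open>y = r ^ k\<close>.\<close>
    also have "\<dots> \<le> (\<Sum>l. ennreal ?a * ennreal (real p ^ Suc l * tail (r ^ k / c ^ Suc l)))"
    proof (intro suminf_le summableI)
      fix l
      have "prob (\<Union>n<p ^ Suc l. E k l n) \<le> (\<Sum>n<p ^ Suc l. prob (E k l n))"
        by (intro finite_measure_subadditive_finite) auto
      also have "\<dots> \<le> (\<Sum>n<p ^ Suc l. ?a * tail (r ^ k / c ^ Suc l))"
        by (intro sum_mono E_le)
      finally show "emeasure M (\<Union>n<p ^ Suc l. E k l n)
          \<le> ennreal ?a * ennreal (real p ^ Suc l * tail (r ^ k / c ^ Suc l))"
        by (simp add: emeasure_eq_measure tail_nonneg flip: ennreal_mult' del: power_Suc)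
          (simp add: ennreal_leI mult_ac)
    qed
    also have "\<dots> = ennreal ?a * (\<Sum>l. ennreal (real p ^ Suc l * tail (r ^ k / c ^ Suc l)))"
      by simp
    also have "\<dots> \<le> ennreal ?a * ennreal (C * (r ^ k) powr - q)"
      using r by (intro mult_left_mono levels_le) auto
    also have "\<dots> \<le> ennreal (C * (r ^ k / c ^ Suc k) powr - q) * ennreal (C * (r ^ k) powr - q)"
      using r c by (intro mult_right_mono ennreal_leI tail_le) auto
    also have "\<dots> = ennreal (C * (r ^ k / c ^ Suc k) powr - q * (C * (r ^ k) powr - q))"
      using C by (simp flip: ennreal_mult)
    finally have "prob (D k) \<le> C * (r ^ k / c ^ Suc k) powr - q * (C * (r ^ k) powr - q)"
      using C by (simp add: emeasure_eq_measure ennreal_le_iff)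
    also have "\<dots> = C\<^sup>2 * ((r ^ k / c ^ Suc k) powr - q * (r ^ k) powr - q)"
      by (simp add: power2_eq_square)
    also have "(r ^ k / c ^ Suc k) powr - q * (r ^ k) powr - q = (p powr (-1/2)) ^ k * (1 / p)"
    proof -
      have rk: "r ^ k = c powr (k / 4)"
        using c by (simp add: r_def powr_realpow[symmetric] powr_powr)
      have ck: "c ^ Suc k = c powr (k + 1)" using c by (simp add: powr_add powr_realpow)
      have "(r ^ k / c ^ Suc k) powr - q * (r ^ k) powr - q
          = c powr ((k / 4 - (k + 1)) * - q + k / 4 * - q)"
        unfolding rk ck using c by (simp add: powr_diff[symmetric] powr_powr powr_add[symmetric])
      also have "(k / 4 - (k + 1)) * - q + k / 4 * - q = q * (k / 2 + 1)"
        by (simp add: field_simps)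
      also have "c powr \<dots> = (1 / p) powr (k / 2 + 1)" unfolding powr_powr[symmetric] pq ..
      also have "\<dots> = p powr (- 1 / 2 * k) * (1 / p)"
        using p2 by (simp add: powr_add powr_divide powr_minus_divide)
      also have "p powr (- 1 / 2 * k) = (p powr (- 1 / 2)) ^ k"
        using p2 powr_power[of "real p" "- 1 / 2" k] by simp
      finally show ?thesis by simp
    qed
    also have "C\<^sup>2 * ((p powr (-1/2)) ^ k * (1 / p)) \<le> C\<^sup>2 * ((p powr (-1/2)) ^ k * 1)"
      using p2 by (intro mult_left_mono) auto
    finally show ?thesis by simp
  qed
  have "p powr (-1/2) < 1" using p2 powr_less_mono[of "-1/2" 0 "real p"] by simp
  then have "summable (\<lambda>k. C\<^sup>2 * (p powr (-1/2)) ^ k)"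
    by (intro summable_mult summable_geometric) simp
  then have "summable (\<lambda>k. prob (D k))"
    by (rule summable_comparison_test') (use D_le in auto)
  then have ev: "AE \<omega> in M. eventually (\<lambda>k. \<omega> \<in> space M - D k) sequentially"
    by (intro borel_cantelli_AE1) (auto simp: emeasure_eq_measure)
  have "(\<Sum>k. ennreal (real p ^ Suc k * tail (1 / c ^ Suc k))) < \<infinity>"
    using levels_le[of 1] by (auto simp: less_top[symmetric] top_unique)
  then have "summable (\<lambda>k. real p ^ Suc k * tail (1 / c ^ Suc k))"
    by (intro summable_suminf_not_top) (auto simp: tail_nonneg)
  from AE_terms_bounded[OF this] ev show ?thesis
  proof eventually_elim
    case (elim \<omega>)
    then obtain B K where B: "\<And>k n. c ^ Suc k * \<bar>W k n \<omega>\<bar> \<le> B"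
      and K: "\<And>k. k \<ge> K \<Longrightarrow> \<omega> \<in> space M - D k"
      unfolding eventually_sequentially by blast
    have "(\<Sum>k<m. c ^ Suc k * \<bar>W k n \<omega>\<bar>) \<le> real K * B + B + 2 / (1 - r)" for n m
    proof (rule lacunary_sum_bound[OF _ B r])
      show "0 \<le> c ^ Suc k * \<bar>W k n \<omega>\<bar>" for k using c by simp
      fix k l assume kl: "K \<le> k" "k < l"
      \<comment> \<open>\<open>D k\<close> only speaks of representatives below
        \<open>p ^ Suc l\<close>. Passing to one keeps the node at level \<open>k\<close> as well,
        because \<open>p ^ Suc k\<close> divides \<open>p ^ Suc l\<close>.\<close>
      define n' where "n' = n mod p ^ Suc l"
      have n': "n' < p ^ Suc l" unfolding n'_def using p2 by (intro mod_less_divisor) auto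
      have "n' mod p ^ Suc k = n mod p ^ Suc k"
        unfolding n'_def using kl by (intro mod_mod_cancel le_imp_power_dvd) auto
      then have W': "W k n' = W k n" "W l n' = W l n"
        using W_mod[of k n'] W_mod[of k n] W_mod[of l n] by (simp_all add: n'_def)
      have "\<omega> \<notin> E k l n'" "\<omega> \<in> space M" using K[OF kl(1)] n' unfolding D_def by auto
      then have "\<not> (r ^ k < c ^ Suc k * \<bar>W k n \<omega>\<bar> \<and> r ^ k < c ^ Suc l * \<bar>W l n \<omega>\<bar>)"
        unfolding less_weight_iff using kl by (auto simp: E_def W')
      then show "c ^ Suc k * \<bar>W k n \<omega>\<bar> \<le> r ^ k \<or> c ^ Suc l * \<bar>W l n \<omega>\<bar> \<le> r ^ k"
        by linarith
    qed
    then show ?case by blast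
  qed
qed

section \<open>Infinite moment: large values with probability bounded below\<close>

text \<open>The bound 1/8 and the subtracted series are independent of \<open>a\<close>, so
  \<open>a\<close> can later be sent to infinity with \<open>t\<close> fixed.\<close>

lemma prob_large_value:
  assumes C: "0 \<le> C" and \<alpha>: "0 < \<alpha>" and t: "0 < t"
    and tail_le: "\<And>s. 0 < s \<Longrightarrow> tail s \<le> C * s powr - \<alpha>"
    and small: "summable (\<lambda>k. tail (t / sqrt c ^ Suc k))" "(\<Sum>k. tail (t / sqrt c ^ Suc k)) \<le> 1/8"
    and a: "0 < a" "C * a powr - \<alpha> \<le> 1/4"
    and inf: "(\<Sum>k. ennreal (real p ^ Suc k * tail (a / c ^ Suc k))) = \<infinity>"
  shows "\<exists>V\<in>events. 1/8 \<le> prob V \<and> (\<forall>\<omega>\<in>V. \<exists>n. a - 2 * (\<Sum>k. t * sqrt c ^ Suc k)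
    \<le> \<bar>\<Sum>k. c ^ Suc k * (W k n \<omega> - W k 0 \<omega>)\<bar>)"
proof -
  \<comment> \<open>The weight splits as \<open>c ^ k = \<rho> ^ k * \<rho> ^ k\<close>: one factor
    raises the threshold in \<open>E\<close>, making the exceptional probabilities summable, and the
    other keeps the tame terms below a geometric series.\<close>
  define \<rho> where "\<rho> = sqrt c"
  have \<rho>: "0 < \<rho>" "\<rho> < 1" "\<rho> * \<rho> = c" using c by (auto simp: \<rho>_def)
  define d where "d k = tail (t / \<rho> ^ Suc k)" for k
  have d: "summable d" "suminf d \<le> 1/8" "\<And>k. 0 \<le> d k"
    using small by (auto simp: d_def[abs_def] \<rho>_def tail_nonneg)
  define E where "E k n = {\<omega> \<in> space M. t / \<rho> ^ Suc k < \<bar>W k n \<omega>\<bar>}" for k n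
  have E [measurable]: "E k n \<in> events" for k n unfolding E_def by measurable
  define H where "H u = {\<omega> \<in> space M. a / c ^ Suc (fst u) < \<bar>W (fst u) (snd u) \<omega>\<bar>}" for u :: "nat \<times> nat"
  have H [measurable]: "H u \<in> events" for u unfolding H_def by measurable
  define h where "h u = tail (a / c ^ Suc (fst u))" for u :: "nat \<times> nat"
  have h0: "0 \<le> h u" for u by (simp add: h_def tail_nonneg)
  have pH: "prob (H u) = h u" for u by (simp add: H_def h_def prob_W)
  have h4: "h u \<le> 1/4" for u
  proof -
    have c1: "0 < c ^ Suc (fst u)" "c ^ Suc (fst u) \<le> 1"
      using c by (auto intro!: power_le_one simp del: power_Suc)
    then have "a \<le> a / c ^ Suc (fst u)" using a by (simp add: le_divide_eq del: power_Suc)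
    then have "C * (a / c ^ Suc (fst u)) powr - \<alpha> \<le> C * a powr - \<alpha>"
      using a C \<alpha> by (intro mult_left_mono powr_mono2') auto
    moreover have "h u \<le> C * (a / c ^ Suc (fst u)) powr - \<alpha>"
      unfolding h_def using a c1 by (intro tail_le) (simp del: power_Suc)
    ultimately show ?thesis using a by linarith
  qed
  \<comment> \<open>\<open>R u\<close> spoils the rest of the branch through \<open>u\<close>. Each
    of its events sits at another level, so it is independent of \<open>H u\<close>, and the union
    bound costs \<open>H u\<close> at most the fraction \<open>suminf d \<le> 1/8\<close>.\<close>
  define R where "R u = (\<Union>k\<in>-{fst u}. E k (snd u))" for u :: "nat \<times> nat"
  have R [measurable]: "R u \<in> events" for u unfolding R_def by measurable
  define G where "G u = H u - R u" for u
  have G [measurable]: "G u \<in> events" for u unfolding G_def by measurable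
  have pHR: "prob (H u \<inter> R u) \<le> h u / 8" for u
  proof -
    define A where "A k = (if k = fst u then {} else H u \<inter> E k (snd u))" for k
    have A [measurable]: "A k \<in> events" for k unfolding A_def by (cases "k = fst u") simp_all
    have Ale: "prob (A k) \<le> h u * d k" for k
    proof (cases "k = fst u")
      case True
      then show ?thesis using h0 d by (simp add: A_def)
    next
      case False
      then have "prob (A k) = h u * d k"
        unfolding h_def d_def
        by (subst prob_W2[of "fst u" "snd u" k "snd u", symmetric])
          (auto simp: A_def H_def E_def intro!: arg_cong[where f=prob])
      then show ?thesis by simp
    qed
    have sm: "summable (\<lambda>k. h u * d k)" using d by (intro summable_mult)
    have sA: "summable (\<lambda>k. prob (A k))"
      by (rule summable_comparison_test'[OF sm]) (use Ale in auto)
    have "prob (H u \<inter> R u) = prob (\<Union>k. A k)"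
      by (rule arg_cong[where f=prob]) (auto simp: A_def R_def split: if_splits)
    also have "\<dots> \<le> (\<Sum>k. prob (A k))"
      by (rule finite_measure_subadditive_countably[OF _ sA]) auto
    also have "\<dots> \<le> (\<Sum>k. h u * d k)" by (intro suminf_le Ale sA sm)
    also have "\<dots> = h u * suminf d" using d by (simp add: suminf_mult)
    also have "\<dots> \<le> h u * (1/8)" using d h0 by (intro mult_left_mono) auto
    finally show ?thesis by simp
  qed
  have pG: "7/8 * h u \<le> prob (G u)" for u
    using finite_measure_Diff'[of "H u" "R u"] pHR[of u] pH[of u] by (simp add: G_def)
  \<comment> \<open>The range conditions make \<open>snd u\<close> and \<open>snd v\<close> their
    own residues, so distinct pairs are distinct nodes.\<close>
  have pGG: "prob (G u \<inter> G v) \<le> h u * h v"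
    if "snd u < p ^ Suc (fst u)" "snd v < p ^ Suc (fst v)" "u \<noteq> v" for u v
  proof -
    have "prob (G u \<inter> G v) \<le> prob (H u \<inter> H v)"
      by (intro finite_measure_mono) (auto simp: G_def)
    also have "H u \<inter> H v = {\<omega> \<in> space M. a / c ^ Suc (fst u) < \<bar>W (fst u) (snd u) \<omega>\<bar> \<and>
        a / c ^ Suc (fst v) < \<bar>W (fst v) (snd v) \<omega>\<bar>}"
      by (auto simp: H_def)
    also have "prob \<dots> = h u * h v"
      unfolding h_def using that by (intro prob_W2) (auto simp: prod_eq_iff)
    finally show ?thesis .
  qed

  have "\<exists>m. 1/2 \<le> (\<Sum>k<m. real p ^ Suc k * tail (a / c ^ Suc k))"
  proof (rule ccontr)
    assume "\<not> ?thesis"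
    then have "(\<Sum>k<m. real p ^ Suc k * tail (a / c ^ Suc k)) \<le> 1/2" for m
      by (meson less_imp_le not_le)
    then have "(\<Sum>k\<le>m. real p ^ Suc k * tail (a / c ^ Suc k)) \<le> 1/2" for m
      unfolding lessThan_Suc_atMost[symmetric] .
    then have "summable (\<lambda>k. real p ^ Suc k * tail (a / c ^ Suc k))"
      by (intro bounded_imp_summable[where B = "1/2"]) (auto simp: tail_nonneg)
    then have "(\<Sum>k. ennreal (real p ^ Suc k * tail (a / c ^ Suc k)))
        = ennreal (\<Sum>k. real p ^ Suc k * tail (a / c ^ Suc k))"
      by (intro suminf_ennreal2) (auto simp: tail_nonneg)
    then show False using inf by simp
  qed
  then obtain m where m: "1/2 \<le> (\<Sum>k<m. real p ^ Suc k * tail (a / c ^ Suc k))" by blast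
  define I where "I = (SIGMA k:{..<m}. {..<p ^ Suc k})"
  have I: "finite I" "\<And>u. u \<in> I \<Longrightarrow> snd u < p ^ Suc (fst u)" by (auto simp: I_def simp del: power_Suc)
  have "sum h I = (\<Sum>k<m. \<Sum>n<p ^ Suc k. h (k, n))"
    unfolding I_def by (subst sum.Sigma) (auto simp: case_prod_unfold)
  also have "\<dots> = (\<Sum>k<m. real p ^ Suc k * tail (a / c ^ Suc k))" by (simp add: h_def)
  finally have "1/2 \<le> sum h I" using m by simp
  \<comment> \<open>No single \<open>h u\<close> exceeds 1/4, so the total can be steered into the
    window from 1/2 to 3/4, where the Bonferroni bound is positive.\<close>
  then obtain J where J: "J \<subseteq> I" "1/2 \<le> sum h J" "sum h J \<le> 1/2 + 1/4"
    using subset_sum_between[of I h "1/4" "1/2"] I h4 by auto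
  have finJ: "finite J" using J I finite_subset by blast
  define U where "U = (\<Union>u\<in>J. G u)"
  have U [measurable]: "U \<in> events" unfolding U_def using finJ by (intro sets.finite_UN) auto
  have "prob (G u \<inter> G v) \<le> h u * h v" if "u \<in> J" "v \<in> J" "u \<noteq> v" for u v
    using that J(1) I(2) by (intro pGG) blast+
  then have "7/8 * sum h J - (sum h J)\<^sup>2 / 2 \<le> prob U"
    unfolding U_def by (rule bonferroni_pairwise[OF finJ G pG])
  \<comment> \<open>Write \<open>s = sum h J\<close>. The product gives
    \<open>5/8 * s - s\<^sup>2 / 2 \<ge> 3/16\<close>, and the remaining \<open>s / 4\<close> is at
    least 1/8.\<close>
  moreover have "0 \<le> (sum h J - 1/2) * (3/4 - sum h J)" using J by (intro mult_nonneg_nonneg) auto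
  ultimately have pU: "1/4 \<le> prob U" using J by (simp add: power2_eq_square algebra_simps)

  define R0 where "R0 = (\<Union>k. E k 0)"
  have R0 [measurable]: "R0 \<in> events" unfolding R0_def by measurable
  have "prob R0 \<le> (\<Sum>k. prob (E k 0))" unfolding R0_def
    using d by (intro finite_measure_subadditive_countably) (auto simp: E_def prob_W d_def[abs_def])
  also have "\<dots> = suminf d" by (simp add: E_def prob_W d_def[abs_def])
  finally have pR0: "prob R0 \<le> 1/8" using d by simp

  have "prob (U \<inter> R0) \<le> prob R0" by (intro finite_measure_mono) auto
  then have pV: "1/8 \<le> prob (U - R0)"
    using finite_measure_Diff'[of U R0] pU pR0 by simp

  show ?thesis
  proof (intro bexI[of _ "U - R0"] conjI ballI pV)
    fix \<omega> assume \<omega>: "\<omega> \<in> U - R0"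
    then obtain u where u: "\<omega> \<in> G u" unfolding U_def by auto
    obtain k n where kn: "u = (k, n)" by (cases u)
    have sp: "\<omega> \<in> space M" using u by (auto simp: G_def H_def)
    have scale: "c ^ Suc j * \<bar>x\<bar> \<le> t * \<rho> ^ Suc j" if "\<not> t / \<rho> ^ Suc j < \<bar>x\<bar>" for j x
    proof -
      have "c ^ Suc j * \<bar>x\<bar> \<le> c ^ Suc j * (t / \<rho> ^ Suc j)"
        using that c by (intro mult_left_mono) auto
      also have "\<dots> = (\<rho> ^ Suc j * \<rho> ^ Suc j) * (t / \<rho> ^ Suc j)"
        by (simp only: \<rho>(3)[symmetric] power_mult_distrib)
      also have "\<dots> = t * \<rho> ^ Suc j" using \<rho> by simp
      finally show ?thesis .
    qed
    have b0: "c ^ Suc j * \<bar>W j 0 \<omega>\<bar> \<le> t * \<rho> ^ Suc j" for j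
      using \<omega> sp by (intro scale) (auto simp: R0_def E_def)
    have bn: "c ^ Suc j * \<bar>W j n \<omega>\<bar> \<le> t * \<rho> ^ Suc j" if "j \<noteq> k" for j
      using u sp that kn by (intro scale) (auto simp: G_def R_def E_def)
    have big: "a < c ^ Suc k * \<bar>W k n \<omega>\<bar>"
      unfolding less_weight_iff using u kn by (auto simp: G_def H_def)
    \<comment> \<open>\<open>z\<close> carries the large term alone; \<open>e\<close> keeps
      everything else, including the value of the branch of 0 at level \<open>k\<close>. Since
      \<open>e\<close> is absolutely summable, the series for \<open>X\<close> converges on this
      event and \<open>suminf\<close> is its true sum.\<close>
    define e where "e j = c ^ Suc j * ((if j = k then 0 else W j n \<omega>) - W j 0 \<omega>)" for j
    define z where "z j = (if j = k then c ^ Suc k * W k n \<omega> else 0)" for j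
    have "\<bar>e j\<bar> \<le> 2 * (t * \<rho> ^ Suc j)" for j
    proof -
      have "0 \<le> t * \<rho> ^ Suc j" using t \<rho> by simp
      then have e1: "c ^ Suc j * \<bar>if j = k then 0 else W j n \<omega>\<bar> \<le> t * \<rho> ^ Suc j"
        using bn[of j] by (cases "j = k") auto
      have "\<bar>e j\<bar> \<le> c ^ Suc j * (\<bar>if j = k then 0 else W j n \<omega>\<bar> + \<bar>W j 0 \<omega>\<bar>)"
        unfolding e_def abs_mult using c by (intro mult_mono abs_triangle_ineq4) auto
      also have "\<dots> \<le> 2 * (t * \<rho> ^ Suc j)"
        using b0[of j] e1 unfolding distrib_left by linarith
      finally show ?thesis .
    qed
    moreover have s\<rho>: "summable (\<lambda>j. t * \<rho> ^ Suc j)"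
      using \<rho> summable_mult[OF summable_geometric[of \<rho>], of "t * \<rho>"] by (simp add: mult.assoc)
    ultimately have e: "summable (\<lambda>j. \<bar>e j\<bar>)" "(\<Sum>j. \<bar>e j\<bar>) \<le> (\<Sum>j. 2 * (t * \<rho> ^ Suc j))"
      using summable_mult[OF s\<rho>, of 2]
      by (auto intro!: suminf_le summable_comparison_test'[of "\<lambda>j. 2 * (t * \<rho> ^ Suc j)" 0 "\<lambda>j. \<bar>e j\<bar>"]
          simp del: power_Suc)
    have z: "z sums (c ^ Suc k * W k n \<omega>)"
      unfolding z_def by (rule sums_single)
    have "(\<Sum>j. c ^ Suc j * (W j n \<omega> - W j 0 \<omega>)) = (\<Sum>j. z j + e j)"
      by (intro arg_cong[where f=suminf]) (auto simp: z_def e_def fun_eq_iff algebra_simps)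
    also have "\<dots> = c ^ Suc k * W k n \<omega> + suminf e"
      using sums_add[OF z summable_sums[OF summable_rabs_cancel[OF e(1)]]] by (simp add: sums_iff)
    finally have X: "(\<Sum>j. c ^ Suc j * (W j n \<omega> - W j 0 \<omega>)) = c ^ Suc k * W k n \<omega> + suminf e" .
    have "\<bar>suminf e\<bar> \<le> 2 * (\<Sum>j. t * \<rho> ^ Suc j)"
      using summable_rabs[OF e(1)] e(2) s\<rho> by (simp add: suminf_mult del: power_Suc)
    moreover have "\<bar>c ^ Suc k * W k n \<omega>\<bar> = c ^ Suc k * \<bar>W k n \<omega>\<bar>" using c by (simp add: abs_mult)
    ultimately have "a - 2 * (\<Sum>j. t * \<rho> ^ Suc j) \<le> \<bar>\<Sum>j. c ^ Suc j * (W j n \<omega> - W j 0 \<omega>)\<bar>"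
      unfolding X using big by linarith
    then show "\<exists>n. a - 2 * (\<Sum>k. t * sqrt c ^ Suc k)
        \<le> \<bar>\<Sum>k. c ^ Suc k * (W k n \<omega> - W k 0 \<omega>)\<bar>"
      unfolding \<rho>_def by blast
  qed auto
qed

text \<open>The events that some \<open>\<bar>X n\<bar>\<close> exceeds \<open>i\<close> decrease in
  \<open>i\<close> and all have probability at least 1/8, so by continuity from above the paths are
  unbounded with probability at least 1/8. The moment of order \<open>\<alpha>\<close> provides
  \<open>t\<close> and \<open>a\<close> for \<open>prob_large_value\<close>.\<close>

lemma not_AE_bounded:
  assumes C: "0 \<le> C" and \<alpha>: "0 < \<alpha>"
    and tail_le: "\<And>s. 0 < s \<Longrightarrow> tail s \<le> C * s powr - \<alpha>"
    and inf: "\<And>a. 0 < a \<Longrightarrow> (\<Sum>k. ennreal (real p ^ Suc k * tail (a / c ^ Suc k))) = \<infinity>"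
  shows "\<not> (AE \<omega> in M. \<exists>B. \<forall>n. \<bar>\<Sum>k. c ^ Suc k * (W k n \<omega> - W k 0 \<omega>)\<bar> \<le> B)"
proof
  assume AE: "AE \<omega> in M. \<exists>B. \<forall>n. \<bar>\<Sum>k. c ^ Suc k * (W k n \<omega> - W k 0 \<omega>)\<bar> \<le> B"
  define X where "X n \<omega> = (\<Sum>k. c ^ Suc k * (W k n \<omega> - W k 0 \<omega>))" for n \<omega>
  have X [measurable]: "X n \<in> borel_measurable M" for n unfolding X_def by measurable
  define \<sigma> where "\<sigma> = sqrt c powr \<alpha>"
  have \<sigma>: "0 < \<sigma>" "\<sigma> < 1"
    using c \<alpha> powr_less_mono2[of \<alpha> "sqrt c" 1] by (auto simp: \<sigma>_def)
  define \<kappa> where "\<kappa> = \<sigma> / (1 - \<sigma>)"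
  have \<kappa>0: "0 \<le> \<kappa>" using \<sigma> by (simp add: \<kappa>_def)
  have \<kappa>: "(\<lambda>k. \<sigma> ^ Suc k) sums \<kappa>"
    using sums_mult[OF geometric_sums[of \<sigma>], of \<sigma>] \<sigma> by (simp add: \<kappa>_def)
  \<comment> \<open>The tails sum to at most \<open>C * t powr - \<alpha> * \<kappa>\<close>, which
    this \<open>t\<close> brings below 1/8; the added 1 keeps the base positive when
    \<open>C = 0\<close>.\<close>
  define t where "t = (8 * C * \<kappa> + 1) powr (1 / \<alpha>)"
  have pos: "0 < 8 * C * \<kappa> + 1" using C \<kappa>0 by (simp add: add_nonneg_pos)
  have t: "0 < t" using pos by (simp add: t_def)
  have t\<alpha>: "t powr - \<alpha> = 1 / (8 * C * \<kappa> + 1)"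
    using pos \<alpha> by (simp add: t_def powr_powr powr_minus_divide)
  have le: "tail (t / sqrt c ^ Suc k) \<le> C * t powr - \<alpha> * \<sigma> ^ Suc k" for k
  proof -
    have "tail (t / sqrt c ^ Suc k) \<le> C * (t / sqrt c ^ Suc k) powr - \<alpha>"
      using t c by (intro tail_le) simp
    also have "(t / sqrt c ^ Suc k) powr - \<alpha> = t powr - \<alpha> * (sqrt c ^ Suc k) powr \<alpha>"
      using t c by (simp add: powr_divide powr_minus_divide)
    also have "(sqrt c ^ Suc k) powr \<alpha> = \<sigma> ^ Suc k"
      unfolding \<sigma>_def using c by (subst (1 2) powr_realpow[symmetric]) (auto simp: powr_powr mult.commute)
    finally show ?thesis by (simp add: mult.assoc)
  qed
  have maj: "(\<lambda>k. C * t powr - \<alpha> * \<sigma> ^ Suc k) sums (C * t powr - \<alpha> * \<kappa>)"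
    by (rule sums_mult[OF \<kappa>])
  have sm: "summable (\<lambda>k. tail (t / sqrt c ^ Suc k))"
    by (rule summable_comparison_test'[OF sums_summable[OF maj]]) (use le tail_nonneg in auto)
  have "(\<Sum>k. tail (t / sqrt c ^ Suc k)) \<le> C * t powr - \<alpha> * \<kappa>"
    using suminf_le[OF le sm sums_summable[OF maj]] maj by (simp add: sums_iff)
  also have "\<dots> \<le> 1/8" using pos by (simp add: t\<alpha> divide_le_eq)
  finally have small: "(\<Sum>k. tail (t / sqrt c ^ Suc k)) \<le> 1/8" .

  define V where "V i = {\<omega> \<in> space M. \<exists>n. real i < \<bar>X n \<omega>\<bar>}" for i :: nat
  have V [measurable]: "V i \<in> events" for i unfolding V_def by measurable
  have pV: "1/8 \<le> prob (V i)" for i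
  proof -
    let ?b = "2 * (\<Sum>k. t * sqrt c ^ Suc k)"
    \<comment> \<open>The power gives \<open>C * a powr - \<alpha> \<le> 1/4\<close>, and the last
      entry leaves more than \<open>i\<close> after subtracting \<open>?b\<close>.\<close>
    define a where "a = max (max 1 ((4 * C + 1) powr (1 / \<alpha>))) (?b + i + 1)"
    have a: "0 < a" "i < a - ?b" "(4 * C + 1) powr (1 / \<alpha>) \<le> a" unfolding a_def by linarith+
    have "a powr - \<alpha> \<le> ((4 * C + 1) powr (1 / \<alpha>)) powr - \<alpha>"
      using a C \<alpha> by (intro powr_mono2') auto
    also have "\<dots> = 1 / (4 * C + 1)" using C \<alpha> by (simp add: powr_powr powr_minus_divide)
    finally have "C * a powr - \<alpha> \<le> C * (1 / (4 * C + 1))" using C by (rule mult_left_mono)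
    also have "\<dots> \<le> 1/4" using C by (simp add: divide_le_eq)
    finally have "C * a powr - \<alpha> \<le> 1/4" .
    from prob_large_value[OF C \<alpha> t tail_le sm small a(1) this inf[OF a(1)]]
    obtain V' where V': "V' \<in> events" "1/8 \<le> prob V'"
      "\<And>\<omega>. \<omega> \<in> V' \<Longrightarrow> \<exists>n. a - ?b \<le> \<bar>X n \<omega>\<bar>" unfolding X_def by blast
    have "V' \<subseteq> V i"
    proof
      fix \<omega> assume \<omega>: "\<omega> \<in> V'"
      then obtain n where "a - ?b \<le> \<bar>X n \<omega>\<bar>" using V'(3) by blast
      then have "real i < \<bar>X n \<omega>\<bar>" using a(2) by linarith
      moreover have "\<omega> \<in> space M" using \<omega> V'(1) sets.sets_into_space by blast
      ultimately show "\<omega> \<in> V i" by (auto simp: V_def)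
    qed
    then have "prob V' \<le> prob (V i)" by (intro finite_measure_mono) auto
    with V' show ?thesis by linarith
  qed
  have "decseq V"
  proof (intro decseq_SucI subsetI)
    fix i \<omega> assume "\<omega> \<in> V (Suc i)"
    then obtain n where "\<omega> \<in> space M" "real (Suc i) < \<bar>X n \<omega>\<bar>" by (auto simp: V_def)
    then have "real i < \<bar>X n \<omega>\<bar>" by simp
    with \<open>\<omega> \<in> space M\<close> show "\<omega> \<in> V i" by (auto simp: V_def)
  qed
  then have "(\<lambda>i. prob (V i)) \<longlonglongrightarrow> prob (\<Inter>i. V i)" by (intro finite_Lim_measure_decseq) auto
  then have "1/8 \<le> prob (\<Inter>i. V i)" using pV by (intro LIMSEQ_le_const) auto
  moreover have "AE \<omega> in M. \<omega> \<notin> (\<Inter>i. V i)"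
    using AE
  proof eventually_elim
    case (elim \<omega>)
    then obtain B where B: "\<And>n. \<bar>X n \<omega>\<bar> \<le> B" unfolding X_def by blast
    obtain i :: nat where "B \<le> real i" using real_arch_simple by blast
    then have "\<bar>X n \<omega>\<bar> \<le> real i" for n using B[of n] by linarith
    then have "\<omega> \<notin> V i" by (simp add: V_def not_less)
    then show ?case by blast
  qed
  then have "prob (\<Inter>i. V i) = 0" by (subst prob_eq_0) auto
  ultimately show False by simp
qed

end

section \<open>Level sums compared with the moment of order q\<close>

text \<open>As \<open>p \<ge> 2\<close>, a geometric sum is at most twice its last term, and the
  last power counted lies below \<open>t\<close>.\<close>

lemma sum_powers_below:
  fixes t :: real
  assumes "2 \<le> p" "0 \<le> t"
  shows "(\<Sum>k<m. if real p ^ Suc k < t then real p ^ Suc k else 0) \<le> 2 * t"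
proof (induction m)
  case 0
  then show ?case using assms by simp
next
  case (Suc m)
  show ?case
  proof (cases "real p ^ Suc m < t")
    case True
    have geo: "(\<Sum>k<i. real p ^ Suc k) \<le> 2 * real p ^ i" for i
    proof (induction i)
      case (Suc i)
      have "2 * real p ^ i \<le> real p * real p ^ i" using assms by (intro mult_right_mono) auto
      with Suc show ?case by simp
    qed simp
    have "(\<Sum>k<Suc m. if real p ^ Suc k < t then real p ^ Suc k else 0) \<le> (\<Sum>k<Suc m. real p ^ Suc k)"
      by (intro sum_mono) auto
    also have "\<dots> \<le> 2 * real p ^ Suc m" by (rule geo)
    finally show ?thesis using True by linarith
  next
    case False
    then show ?thesis using Suc by simp
  qed
qed

text \<open>The largest power below \<open>t\<close> is at least \<open>t / p\<close>. The additive
  \<open>real p\<close> covers \<open>t \<le> real p\<close>, where the sum is empty because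
  exponents start at 1.\<close>

lemma le_sum_powers_below:
  fixes t :: real
  assumes "2 \<le> p"
  shows "\<exists>m. t \<le> real p + real p * (\<Sum>k<m. if real p ^ Suc k < t then real p ^ Suc k else 0)"
proof (cases "t \<le> real p")
  case True
  then show ?thesis by (intro exI[of _ 0]) simp
next
  case False
  define j where "j = (LEAST j. t \<le> real p ^ j)"
  have "\<exists>j. t \<le> real p ^ j"
    using real_arch_pow[of "real p" t] assms by (auto intro: less_imp_le)
  then have j: "t \<le> real p ^ j" unfolding j_def by (rule LeastI_ex)
  have least: "real p ^ i < t" if "i < j" for i
    using not_less_Least[of i "\<lambda>j. t \<le> real p ^ j"] that by (auto simp: j_def)
  have "j \<noteq> 0" "j \<noteq> 1" using j False assms by (auto intro: ccontr)
  then obtain k where k: "j = Suc (Suc k)" by (metis One_nat_def not0_implies_Suc)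
  have "real p ^ Suc k \<le> (\<Sum>k<Suc k. if real p ^ Suc k < t then real p ^ Suc k else 0)"
    using member_le_sum[of k "{..<Suc k}" "\<lambda>k. if real p ^ Suc k < t then real p ^ Suc k else 0"]
      least[of "Suc k"] k by simp
  then have "real p * real p ^ Suc k \<le> real p * (\<Sum>k<Suc k. if real p ^ Suc k < t then real p ^ Suc k else 0)"
    by (intro mult_left_mono) auto
  moreover have "t \<le> real p * real p ^ Suc k" using j k by simp
  ultimately show ?thesis by (intro exI[of _ "Suc k"]) linarith
qed

context prob_space
begin

lemma tail_le_moment:
  fixes Y :: "'a \<Rightarrow> real"
  assumes [measurable]: "Y \<in> borel_measurable M" and q: "0 < q" and s: "0 < s"
    and fin: "(\<integral>\<^sup>+ \<omega>. ennreal (\<bar>Y \<omega>\<bar> powr q) \<partial>M) < \<infinity>"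
  shows "prob {\<omega> \<in> space M. s < \<bar>Y \<omega>\<bar>}
    \<le> enn2real (\<integral>\<^sup>+ \<omega>. ennreal (\<bar>Y \<omega>\<bar> powr q) \<partial>M) * s powr - q"
proof -
  let ?S = "{\<omega> \<in> space M. s < \<bar>Y \<omega>\<bar>}" and ?I = "\<integral>\<^sup>+ \<omega>. ennreal (\<bar>Y \<omega>\<bar> powr q) \<partial>M"
  have S [measurable]: "?S \<in> events" by measurable
  have "ennreal (s powr q * prob ?S) = (\<integral>\<^sup>+ \<omega>. ennreal (s powr q) * indicator ?S \<omega> \<partial>M)"
    by (simp add: nn_integral_cmult_indicator emeasure_eq_measure ennreal_mult)
  also have "\<dots> \<le> ?I"
    using q s by (intro nn_integral_mono) (auto split: split_indicator intro!: ennreal_leI powr_mono2)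
  also have "\<dots> = ennreal (enn2real ?I)" using fin by simp
  finally have "s powr q * prob ?S \<le> enn2real ?I" by (simp add: ennreal_le_iff)
  then show ?thesis using s by (simp add: powr_minus_divide le_divide_eq mult.commute)
qed

text \<open>Since \<open>c powr q = 1 / real p\<close>, raising to the power \<open>q\<close> turns
  the threshold \<open>y / c ^ k\<close> for \<open>\<bar>Y\<bar>\<close> into the threshold
  \<open>p ^ k\<close> for \<open>(\<bar>Y\<bar> / y) powr q\<close>; sum and integral are then
  exchanged.\<close>

lemma level_sum_eq:
  fixes Y :: "'a \<Rightarrow> real"
  assumes [measurable]: "Y \<in> borel_measurable M" and p: "2 \<le> p" and q: "0 < q"
    and c: "0 < c" and cq: "c powr q = 1 / real p" and y: "0 < y"
  shows "(\<Sum>k. ennreal (real p ^ Suc k * prob {\<omega> \<in> space M. y / c ^ Suc k < \<bar>Y \<omega>\<bar>})) =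
    (\<integral>\<^sup>+ \<omega>. (\<Sum>k. ennreal (if real p ^ Suc k < (\<bar>Y \<omega>\<bar> / y) powr q then real p ^ Suc k else 0)) \<partial>M)"
proof -
  have iff: "y / c ^ k < x \<longleftrightarrow> real p ^ k < (x / y) powr q" if "0 \<le> x" for k x
  proof -
    have "(1 / c ^ k) powr q = real p ^ k"
    proof -
      have "(1 / c ^ k) powr q = 1 / (c powr q) ^ k"
        using c by (simp add: powr_divide powr_power powr_powr mult.commute flip: powr_realpow)
      then show ?thesis using p by (simp add: cq power_one_over)
    qed
    moreover have "y / c ^ k < x \<longleftrightarrow> 1 / c ^ k < x / y" using y c by (simp add: field_simps)
    moreover have "1 / c ^ k < x / y \<longleftrightarrow> (1 / c ^ k) powr q < (x / y) powr q"
      using powr_less_mono2[of q "1 / c ^ k" "x / y"] powr_mono2[of q "x / y" "1 / c ^ k"] q c y that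
      by (auto simp: not_less intro: leI dest: leD)
    ultimately show ?thesis by simp
  qed
  have "ennreal (real p ^ Suc k * prob {\<omega> \<in> space M. y / c ^ Suc k < \<bar>Y \<omega>\<bar>}) =
     (\<integral>\<^sup>+ \<omega>. ennreal (if real p ^ Suc k < (\<bar>Y \<omega>\<bar> / y) powr q then real p ^ Suc k else 0) \<partial>M)" for k
  proof -
    let ?S = "{\<omega> \<in> space M. y / c ^ Suc k < \<bar>Y \<omega>\<bar>}"
    have S [measurable]: "?S \<in> events" by measurable
    have "ennreal (real p ^ Suc k * prob ?S) = (\<integral>\<^sup>+ \<omega>. ennreal (real p ^ Suc k) * indicator ?S \<omega> \<partial>M)"
      by (simp add: nn_integral_cmult_indicator emeasure_eq_measure ennreal_mult del: power_Suc)
    also have "\<dots> = (\<integral>\<^sup>+ \<omega>. ennreal (if real p ^ Suc k < (\<bar>Y \<omega>\<bar> / y) powr q then real p ^ Suc k else 0) \<partial>M)"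
      by (intro nn_integral_cong) (auto simp: iff split: split_indicator simp del: power_Suc)
    finally show ?thesis .
  qed
  then show ?thesis by (subst nn_integral_suminf) auto
qed

lemma level_sum_le_moment:
  fixes Y :: "'a \<Rightarrow> real"
  assumes [measurable]: "Y \<in> borel_measurable M" and p: "2 \<le> p" and q: "0 < q"
    and c: "0 < c" and cq: "c powr q = 1 / real p" and y: "0 < y"
  shows "(\<Sum>k. ennreal (real p ^ Suc k * prob {\<omega> \<in> space M. y / c ^ Suc k < \<bar>Y \<omega>\<bar>}))
    \<le> ennreal (2 * y powr - q) * (\<integral>\<^sup>+ \<omega>. ennreal (\<bar>Y \<omega>\<bar> powr q) \<partial>M)"
proof -
  have "(\<Sum>k. ennreal (if real p ^ Suc k < t then real p ^ Suc k else 0)) \<le> ennreal (2 * t)"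
    if "0 \<le> t" for t
  proof (rule suminf_le_const)
    show "(\<Sum>k<m. ennreal (if real p ^ Suc k < t then real p ^ Suc k else 0)) \<le> ennreal (2 * t)" for m
      using sum_powers_below[OF p that, of m] by (subst sum_ennreal) (auto intro!: ennreal_leI)
  qed auto
  then have "(\<integral>\<^sup>+ \<omega>. (\<Sum>k. ennreal (if real p ^ Suc k < (\<bar>Y \<omega>\<bar> / y) powr q then real p ^ Suc k else 0)) \<partial>M)
      \<le> (\<integral>\<^sup>+ \<omega>. ennreal (2 * (\<bar>Y \<omega>\<bar> / y) powr q) \<partial>M)"
    by (intro nn_integral_mono) auto
  also have "\<dots> = (\<integral>\<^sup>+ \<omega>. ennreal (2 * y powr - q) * ennreal (\<bar>Y \<omega>\<bar> powr q) \<partial>M)"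
    using y by (intro nn_integral_cong) (simp add: powr_divide powr_minus_divide flip: ennreal_mult)
  also have "\<dots> = ennreal (2 * y powr - q) * (\<integral>\<^sup>+ \<omega>. ennreal (\<bar>Y \<omega>\<bar> powr q) \<partial>M)"
    by (intro nn_integral_cmult) auto
  finally show ?thesis unfolding level_sum_eq[OF assms] .
qed

text \<open>Integrating \<open>le_sum_powers_below\<close> at
  \<open>(\<bar>Y\<bar> / y) powr q\<close> suffices, as the additive constant has finite integral
  over a probability space.\<close>

lemma moment_finite_if_level_sum_finite:
  fixes Y :: "'a \<Rightarrow> real"
  assumes [measurable]: "Y \<in> borel_measurable M" and p: "2 \<le> p" and q: "0 < q"
    and c: "0 < c" and cq: "c powr q = 1 / real p" and y: "0 < y"
    and fin: "(\<Sum>k. ennreal (real p ^ Suc k * prob {\<omega> \<in> space M. y / c ^ Suc k < \<bar>Y \<omega>\<bar>})) < \<infinity>"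
  shows "(\<integral>\<^sup>+ \<omega>. ennreal (\<bar>Y \<omega>\<bar> powr q) \<partial>M) < \<infinity>"
proof -
  define T where "T t = (\<Sum>k. ennreal (if real p ^ Suc k < t then real p ^ Suc k else 0))" for t :: real
  have T [measurable]: "T \<in> borel_measurable borel" unfolding T_def by measurable
  have le: "ennreal t \<le> ennreal (real p) + ennreal (real p) * T t" for t
  proof -
    let ?f = "\<lambda>k. if real p ^ Suc k < t then real p ^ Suc k else 0"
    obtain m where "t \<le> real p + real p * (\<Sum>k<m. ?f k)" using le_sum_powers_below[OF p] by blast
    then have "ennreal t \<le> ennreal (real p + real p * (\<Sum>k<m. ?f k))" by (rule ennreal_leI)
    also have "\<dots> = ennreal (real p) + ennreal (real p) * (\<Sum>k<m. ennreal (?f k))"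
      by (subst sum_ennreal) (auto simp: ennreal_plus ennreal_mult sum_nonneg)
    also have "\<dots> \<le> ennreal (real p) + ennreal (real p) * T t"
      unfolding T_def by (intro add_left_mono mult_left_mono sum_le_suminf) auto
    finally show ?thesis .
  qed
  have fin': "(\<integral>\<^sup>+ \<omega>. T ((\<bar>Y \<omega>\<bar> / y) powr q) \<partial>M) < \<infinity>"
    using fin unfolding level_sum_eq[OF assms(1-6)] T_def .
  have "(\<integral>\<^sup>+ \<omega>. ennreal (\<bar>Y \<omega>\<bar> powr q) \<partial>M)
      = (\<integral>\<^sup>+ \<omega>. ennreal (y powr q) * ennreal ((\<bar>Y \<omega>\<bar> / y) powr q) \<partial>M)"
    using y by (intro nn_integral_cong) (simp add: powr_divide flip: ennreal_mult)
  also have "\<dots> \<le> (\<integral>\<^sup>+ \<omega>. ennreal (y powr q) * (ennreal (real p) + ennreal (real p) * T ((\<bar>Y \<omega>\<bar> / y) powr q)) \<partial>M)"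
    by (intro nn_integral_mono mult_left_mono le) auto
  also have "\<dots> = ennreal (y powr q) * (ennreal (real p) + ennreal (real p) * (\<integral>\<^sup>+ \<omega>. T ((\<bar>Y \<omega>\<bar> / y) powr q) \<partial>M))"
    by (simp add: nn_integral_cmult nn_integral_add emeasure_space_1)
  also have "\<dots> < \<infinity>" using fin' by (simp add: ennreal_mult_less_top)
  finally show ?thesis .
qed

end

section \<open>Bounded paths and the equivalence\<close>

lemma SUP_ereal_abs_finite_iff:
  "(SUP n. ereal \<bar>x n\<bar>) < \<infinity> \<longleftrightarrow> (\<exists>B. \<forall>n. \<bar>x n\<bar> \<le> B)"
proof
  assume fin: "(SUP n. ereal \<bar>x n\<bar>) < \<infinity>"
  have up: "ereal \<bar>x n\<bar> \<le> (SUP n. ereal \<bar>x n\<bar>)" for n by (intro SUP_upper) auto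
  with fin show "\<exists>B. \<forall>n. \<bar>x n\<bar> \<le> B"
    by (cases "SUP n. ereal \<bar>x n\<bar>") auto
next
  assume "\<exists>B. \<forall>n. \<bar>x n\<bar> \<le> B"
  then obtain B where "\<And>n. \<bar>x n\<bar> \<le> B" by blast
  then have "(SUP n. ereal \<bar>x n\<bar>) \<le> ereal B" by (intro SUP_least) auto
  then show "(SUP n. ereal \<bar>x n\<bar>) < \<infinity>" by (rule le_less_trans) simp
qed

lemma abs_suminf_diff_le:
  fixes u v :: "nat \<Rightarrow> real"
  assumes "\<And>m. (\<Sum>k<m. \<bar>u k\<bar>) \<le> B" "\<And>m. (\<Sum>k<m. \<bar>v k\<bar>) \<le> B"
  shows "\<bar>\<Sum>k. u k - v k\<bar> \<le> 2 * B"
proof -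
  have le: "(\<Sum>k<m. \<bar>u k - v k\<bar>) \<le> 2 * B" for m
  proof -
    have "(\<Sum>k<m. \<bar>u k - v k\<bar>) \<le> (\<Sum>k<m. \<bar>u k\<bar> + \<bar>v k\<bar>)" by (intro sum_mono) auto
    then show ?thesis using assms[of m] by (simp add: sum.distrib)
  qed
  then have "(\<Sum>k\<le>m. \<bar>u k - v k\<bar>) \<le> 2 * B" for m unfolding lessThan_Suc_atMost[symmetric] .
  then have s: "summable (\<lambda>k. \<bar>u k - v k\<bar>)" by (intro bounded_imp_summable[where B = "2 * B"]) auto
  show ?thesis using summable_rabs[OF s] suminf_le_const[OF s le] by linarith
qed

theorem corollary4:
  fixes p :: nat and c \<alpha> :: real
    and N :: "'b measure" and Y :: "'b \<Rightarrow> real"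
    and M :: "'a measure" and Yf :: "nat \<Rightarrow> nat \<Rightarrow> 'a \<Rightarrow> real"
  assumes "prime p" and "0 < c" and "c < 1"
    and "prob_space N" and "Y \<in> borel_measurable N"
    and "0 < \<alpha>" and "(\<integral>\<^sup>+ \<omega>. ennreal (\<bar>Y \<omega>\<bar> powr \<alpha>) \<partial>N) < \<infinity>"
    and "prob_space M"
    and "prob_space.indep_vars M (\<lambda>_. borel) (\<lambda>(k, n). Yf k n) {(k, n). 1 \<le> k \<and> n < p ^ k}"
    and "\<And>k n. 1 \<le> k \<Longrightarrow> n < p ^ k \<Longrightarrow> distr M borel (Yf k n) = distr N borel Y"
  shows "bounded_sample_paths M (series_process p c Yf) \<longleftrightarrow>
    (\<integral>\<^sup>+ \<omega>. ennreal (\<bar>Y \<omega>\<bar> powr (- (ln (real p) / ln c))) \<partial>N) < \<infinity>"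
proof -
  interpret N: prob_space N by fact
  interpret M: prob_space M by fact
  note Y [measurable] = assms(5)
  define q where "q = - (ln (real p) / ln c)"
  have p2: "2 \<le> p" using assms(1) by (rule prime_ge_2_nat)
  have q: "0 < q" using p2 assms(2,3) by (simp add: q_def divide_pos_neg)
  have cq: "c powr q = 1 / real p"
    using p2 assms(2,3) by (simp add: powr_def q_def exp_minus inverse_eq_divide)
  define tail where "tail s = N.prob {\<omega> \<in> space N. s < \<bar>Y \<omega>\<bar>}" for s
  define W where "W k n = periodic_ext p Yf (Suc k) n" for k n
  define I where "I = {(k, n). 1 \<le> k \<and> n < p ^ k}"
  define S where "S s = {x::real. s < \<bar>x\<bar>}" for s
  have S [measurable]: "S s \<in> sets borel" for s unfolding S_def by measurable
  have indep: "M.indep_vars (\<lambda>_. borel) (\<lambda>(k, n). Yf k n) I" using assms(9) unfolding I_def .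
  have Yf_meas: "Yf k n \<in> borel_measurable M" if "(k, n) \<in> I" for k n
    using indep that unfolding M.indep_vars_def by auto
  have prob_Yf: "M.prob (Yf k n -` S s \<inter> space M) = tail s" if "(k, n) \<in> I" for k n s
  proof -
    have "M.prob (Yf k n -` S s \<inter> space M) = measure (distr M borel (Yf k n)) (S s)"
      using Yf_meas[OF that] by (simp add: measure_distr)
    also have "\<dots> = measure (distr N borel Y) (S s)" using that assms(10) by (simp add: I_def)
    also have "\<dots> = tail s"
      by (simp add: measure_distr tail_def S_def vimage_def Collect_conj_eq Int_commute)
    finally show ?thesis .
  qed
  have node: "(Suc k, n mod p ^ Suc k) \<in> I" for k n
    using p2 by (auto simp: I_def simp del: power_Suc)
  have W_eq: "W k n = Yf (Suc k) (n mod p ^ Suc k)" for k n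
    by (auto simp: W_def periodic_ext_def fun_eq_iff)
  interpret level_array M p c W tail
  proof unfold_locales
    show "2 \<le> p" "0 < c" "c < 1" by fact+
    show "W k n \<in> borel_measurable M" for k n unfolding W_eq using Yf_meas node by blast
    show "W k (n mod p ^ Suc k) = W k n" for k n unfolding W_eq by simp
    show "M.prob {\<omega> \<in> space M. s < \<bar>W k n \<omega>\<bar>} = tail s" for k n s
      using prob_Yf[OF node, of k n s]
      by (simp add: W_eq S_def vimage_def Collect_conj_eq Int_commute del: power_Suc)
    fix k n l m s t assume ne: "(k, n mod p ^ Suc k) \<noteq> (l, m mod p ^ Suc l)"
    let ?u = "(Suc k, n mod p ^ Suc k)" and ?v = "(Suc l, m mod p ^ Suc l)"
    have uv: "?u \<noteq> ?v" using ne by simp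
    \<comment> \<open>Independence of the whole family is applied to the two-element subfamily; the
      conditional assigns each node its own threshold.\<close>
    have "M.prob (\<Inter>i\<in>{?u, ?v}. (case i of (k, n) \<Rightarrow> Yf k n) -` S (if i = ?u then s else t) \<inter> space M)
      = (\<Prod>i\<in>{?u, ?v}. M.prob ((case i of (k, n) \<Rightarrow> Yf k n) -` S (if i = ?u then s else t) \<inter> space M))"
      using node by (intro M.indep_varsD[OF indep]) auto
    also have "\<dots> = tail s * tail t"
      using uv prob_Yf[OF node, of k n s] prob_Yf[OF node, of l m t] by (subst prod.insert) auto
    also have "(\<Inter>i\<in>{?u, ?v}. (case i of (k, n) \<Rightarrow> Yf k n) -` S (if i = ?u then s else t) \<inter> space M)
      = {\<omega> \<in> space M. s < \<bar>W k n \<omega>\<bar> \<and> t < \<bar>W l m \<omega>\<bar>}"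
      using uv by (auto simp: W_eq S_def)
    finally show "M.prob {\<omega> \<in> space M. s < \<bar>W k n \<omega>\<bar> \<and> t < \<bar>W l m \<omega>\<bar>} = tail s * tail t" .
  qed
  have bounded_iff: "bounded_sample_paths M (series_process p c Yf) \<longleftrightarrow>
      (AE \<omega> in M. \<exists>B. \<forall>n. \<bar>\<Sum>k. c ^ Suc k * (W k n \<omega> - W k 0 \<omega>)\<bar> \<le> B)"
    unfolding bounded_sample_paths_def series_process_def W_def SUP_ereal_abs_finite_iff ..
  show ?thesis unfolding q_def[symmetric]
  proof
    assume bd: "bounded_sample_paths M (series_process p c Yf)"
    show "(\<integral>\<^sup>+ \<omega>. ennreal (\<bar>Y \<omega>\<bar> powr q) \<partial>N) < \<infinity>"
    proof (rule ccontr)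
      assume inf: "\<not> ?thesis"
      \<comment> \<open>A finite level sum at a single height \<open>a\<close> would already make
        the moment finite.\<close>
      have "(\<Sum>k. ennreal (real p ^ Suc k * tail (a / c ^ Suc k))) = \<infinity>" if "0 < a" for a
        using N.moment_finite_if_level_sum_finite[OF Y p2 q assms(2) cq that] inf
        unfolding tail_def by (auto simp: less_top[symmetric])
      moreover have "tail s \<le> enn2real (\<integral>\<^sup>+ \<omega>. ennreal (\<bar>Y \<omega>\<bar> powr \<alpha>) \<partial>N) * s powr - \<alpha>" if "0 < s" for s
        unfolding tail_def by (rule N.tail_le_moment[OF Y assms(6) that assms(7)])
      ultimately show False
        using not_AE_bounded[OF enn2real_nonneg assms(6)] bd unfolding bounded_iff by blast
    qed
  next
    assume fin: "(\<integral>\<^sup>+ \<omega>. ennreal (\<bar>Y \<omega>\<bar> powr q) \<partial>N) < \<infinity>"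
    define m where "m = enn2real (\<integral>\<^sup>+ \<omega>. ennreal (\<bar>Y \<omega>\<bar> powr q) \<partial>N)"
    have m: "0 \<le> m" "(\<integral>\<^sup>+ \<omega>. ennreal (\<bar>Y \<omega>\<bar> powr q) \<partial>N) = ennreal m"
      using fin by (auto simp: m_def)
    \<comment> \<open>The constant \<open>2 * m\<close> comes from the level sums; the tail bound
      holds with \<open>m\<close> and is weakened so that one constant serves both.\<close>
    have "tail s \<le> 2 * m * s powr - q" if "0 < s" for s
    proof -
      have "tail s \<le> m * s powr - q"
        unfolding tail_def m_def by (rule N.tail_le_moment[OF Y q that fin])
      also have "\<dots> \<le> 2 * m * s powr - q" using m by (intro mult_right_mono) auto
      finally show ?thesis .
    qed
    moreover have "(\<Sum>k. ennreal (real p ^ Suc k * tail (y / c ^ Suc k))) \<le> ennreal (2 * m * y powr - q)"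
      if "0 < y" for y
    proof -
      have "ennreal (2 * y powr - q) * ennreal m = ennreal (2 * m * y powr - q)"
        using m by (simp add: mult_ac flip: ennreal_mult)
      then show ?thesis
        using N.level_sum_le_moment[OF Y p2 q assms(2) cq that] m unfolding tail_def by simp
    qed
    moreover have "0 \<le> 2 * m" using m by simp
    ultimately have "AE \<omega> in M. \<exists>B. \<forall>n m. (\<Sum>k<m. c ^ Suc k * \<bar>W k n \<omega>\<bar>) \<le> B"
      by (intro AE_branch_sums_bounded[OF cq])
    then show "bounded_sample_paths M (series_process p c Yf)"
      unfolding bounded_iff
    proof eventually_elim
      case (elim \<omega>)
      then obtain B where B: "\<And>n m. (\<Sum>k<m. c ^ Suc k * \<bar>W k n \<omega>\<bar>) \<le> B" by blast
      \<comment> \<open>One \<open>B\<close> for the branch of \<open>n\<close> and one for the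
        branch of 0.\<close>
      have "\<bar>\<Sum>k. c ^ Suc k * (W k n \<omega> - W k 0 \<omega>)\<bar> \<le> 2 * B" for n
        unfolding right_diff_distrib
        by (rule abs_suminf_diff_le) (use B assms(2) in \<open>simp_all add: abs_mult\<close>)
      then show ?case by blast
    qed
  qed
qed

end
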